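(* Let $F=(f_1,\ldots,f_m)^\top:\mathbb{R}^n\to\mathbb{R}^m$ be continuously differentiable, let $s\in\mathbb{N}$ with $1\le s<n$, and let $\Omega=\{x\in\mathbb{R}^n\mid \|x\|_0\le s\}$. Assume that: (a) for every $j\in\{1,\ldots,m\}$ the gradient $\nabla f_j$ is Lipschitz-continuous over $\mathbb{R}^n$ with constant $L(f_j)$, i.e. $\|\nabla f_j(x)-\nabla f_j(y)\|\le L(f_j)\|x-y\|$ for all $x,y\in\mathbb{R}^n$; (b) for every $z\in\mathbb{R}^m$ the set $\{x\in\Omega\mid F(x)\le z\}$ is bounded. Let $L>\max_{j\in\{1,\ldots,m\}}L(f_j)$ and let $\{x_k\}$ be an infinite sequence generated by the Multi-Objective Iterative Hard Thresholding algorithm (MOIHT) with constant $L$ from a starting point $x_0\in\Omega$. Then the sequence $\{x_k\}$ admits cluster points, and each cluster point is $L$-stationary for the problem $\min_{x\in\Omega}F(x)$.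
   Context: $\|x\|_0$ denotes the number of nonzero components of $x$, and $\|\cdot\|$ is the Euclidean norm. For $u,v\in\mathbb{R}^m$, $u\le v$ means $u_j\le v_j$ for all $j$. For $L>0$ and $x\in\Omega$ let $\mathcal{D}_L(x)=\{v\in\mathbb{R}^n\mid x+v\in\Omega\}$ and $$\theta_L(x)=\min_{d\in\mathcal{D}_L(x)}\ \max_{j=1,\ldots,m}\nabla f_j(x)^\top d+\frac{L}{2}\|d\|^2 ,$$ and let $v_L(x)$ be the set of optimal solutions $d$ of this minimization problem (not necessarily a singleton, since $\Omega$ is nonconvex). A point $x\in\Omega$ is $L$-stationary if $\theta_L(x)=0$. MOIHT algorithm: given $x_0\in\Omega$ and $L>\max_j L(f_j)$, for $k=0,1,2,\ldots$, as long as $x_k$ is not $L$-stationary, choose any $d_k^L\in v_L(x_k)$ and set $x_{k+1}=x_k+d_k^L$. If some $x_k$ is $L$-stationary, the algorithm stops and returns $x_k$; otherwise it generates an infinite sequence. *)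

theory Defs
  imports "HOL-Analysis.Analysis"
begin

definition continuously_differentiable ::
    "('a::real_normed_vector \<Rightarrow> 'b::real_normed_vector) \<Rightarrow> bool" where
  "continuously_differentiable F \<longleftrightarrow>
     (\<exists>F' :: 'a \<Rightarrow> 'a \<Rightarrow>\<^sub>L 'b.
        (\<forall>x. (F has_derivative blinfun_apply (F' x)) (at x)) \<and> continuous_on UNIV F')"

definition grad :: "('a::real_inner \<Rightarrow> real) \<Rightarrow> 'a \<Rightarrow> 'a" where
  "grad f x = (THE D. GDERIV f x :> D)"

lemma grad_eqI:
  assumes "GDERIV f x :> D"
  shows "grad f x = D"
  unfolding grad_def
proof (rule the_equality)
  show "GDERIV f x :> D" by fact
next
  fix E assume "GDERIV f x :> E"
  then have "(\<lambda>h. h \<bullet> E) = (\<lambda>h. h \<bullet> D)"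
    using assms has_derivative_unique unfolding gderiv_def by blast
  then show "E = D"
    using vector_eq_ldot[of E D] by (auto simp: fun_eq_iff)
qed

definition norm0 :: "real ^ 'n \<Rightarrow> nat" where
  "norm0 x = card {i. x $ i \<noteq> 0}"

definition sparse_set :: "nat \<Rightarrow> (real ^ 'n) set" where
  "sparse_set s = {x. norm0 x \<le> s}"

definition dirs :: "(real ^ 'n) set \<Rightarrow> real ^ 'n \<Rightarrow> (real ^ 'n) set" where
  "dirs \<Omega> x = {v. x + v \<in> \<Omega>}"

definition model ::
    "(real ^ 'n \<Rightarrow> real ^ 'm) \<Rightarrow> real \<Rightarrow> real ^ 'n \<Rightarrow> real ^ 'n \<Rightarrow> real" where
  "model F L x d = (MAX j. grad (\<lambda>y. F y $ j) x \<bullet> d) + L / 2 * (norm d)\<^sup>2"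

text \<open>The infimum below is a minimum for closed \<open>\<Omega>\<close>, \<open>x \<in> \<Omega>\<close> and \<open>L > 0\<close>;
  see \<open>theta_attained\<close>.\<close>

definition theta ::
    "(real ^ 'n \<Rightarrow> real ^ 'm) \<Rightarrow> (real ^ 'n) set \<Rightarrow> real \<Rightarrow> real ^ 'n \<Rightarrow> real" where
  "theta F \<Omega> L x = (INF d \<in> dirs \<Omega> x. model F L x d)"

definition opt_dirs ::
    "(real ^ 'n \<Rightarrow> real ^ 'm) \<Rightarrow> (real ^ 'n) set \<Rightarrow> real \<Rightarrow> real ^ 'n \<Rightarrow> (real ^ 'n) set" where
  "opt_dirs F \<Omega> L x = {d. is_arg_min (model F L x) (\<lambda>d. d \<in> dirs \<Omega> x) d}"

definition L_stationary ::
    "(real ^ 'n \<Rightarrow> real ^ 'm) \<Rightarrow> (real ^ 'n) set \<Rightarrow> real \<Rightarrow> real ^ 'n \<Rightarrow> bool" where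
  "L_stationary F \<Omega> L x \<longleftrightarrow> x \<in> \<Omega> \<and> theta F \<Omega> L x = 0"

text \<open>The infinite runs of the algorithm: no iterate triggers the stopping test.\<close>

definition MOIHT_sequence ::
    "(real ^ 'n \<Rightarrow> real ^ 'm) \<Rightarrow> (real ^ 'n) set \<Rightarrow> real \<Rightarrow> real ^ 'n \<Rightarrow> (nat \<Rightarrow> real ^ 'n) \<Rightarrow> bool" where
  "MOIHT_sequence F \<Omega> L x0 x \<longleftrightarrow>
     x 0 = x0 \<and>
     (\<forall>k. \<not> L_stationary F \<Omega> L (x k) \<and> (\<exists>d \<in> opt_dirs F \<Omega> L (x k). x (Suc k) = x k + d))"

definition cluster_point :: "(nat \<Rightarrow> 'a::topological_space) \<Rightarrow> 'a \<Rightarrow> bool" where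
  "cluster_point x l \<longleftrightarrow> (\<exists>r. strict_mono r \<and> (x \<circ> r) \<longlonglongrightarrow> l)"

lemma closed_sparse_set: "closed (sparse_set s :: (real ^ 'n) set)"
proof -
  have "open {x :: real ^ 'n. \<not> norm0 x \<le> s}"
  proof (subst open_subopen, clarify)
    fix x :: "real ^ 'n" assume x: "\<not> norm0 x \<le> s"
    let ?U = "\<Inter>i \<in> {i. x $ i \<noteq> 0}. {y :: real ^ 'n. y $ i \<noteq> 0}"
    have "open {y :: real ^ 'n. y $ i \<noteq> 0}" for i
      by (intro open_Collect_neq continuous_intros)
    then have "open ?U" by (intro open_INT) auto
    moreover have "x \<in> ?U" by auto
    moreover have "norm0 x \<le> norm0 y" if "y \<in> ?U" for y
      unfolding norm0_def using that by (intro card_mono) auto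
    moreover from this x have "?U \<subseteq> {x. \<not> norm0 x \<le> s}"
      using order_trans by blast
    ultimately show "\<exists>T. open T \<and> x \<in> T \<and> T \<subseteq> {x. \<not> norm0 x \<le> s}"
      by blast
  qed
  then show ?thesis
    unfolding sparse_set_def by (simp add: closed_def Collect_neg_eq)
qed

lemma theta_attained:
  fixes F :: "real ^ 'n \<Rightarrow> real ^ 'm"
  assumes "closed \<Omega>" "x \<in> \<Omega>" "L > 0"
  obtains d where "d \<in> opt_dirs F \<Omega> L x" "theta F \<Omega> L x = model F L x d"
proof -
  let ?g = "\<lambda>j. grad (\<lambda>y. F y $ j) x"
  define R where "R = 2 * norm (?g undefined) / L"
  let ?K = "dirs \<Omega> x \<inter> cball 0 R"
  have R0: "R \<ge> 0" using assms by (simp add: R_def)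
  have 0: "model F L x 0 = 0" by (simp add: model_def)
  have "dirs \<Omega> x = (\<lambda>d. x + d) -` \<Omega>" by (auto simp: dirs_def)
  then have "closed (dirs \<Omega> x)"
    using assms by (simp add: closed_vimage continuous_intros)
  then have "compact ?K" by (simp add: closed_Int_compact)
  moreover have "0 \<in> ?K" using assms R0 by (simp add: dirs_def)
  moreover have "continuous_on ?K (model F L x)"
  proof -
    have *: "continuous_on S (\<lambda>d. Max ((\<lambda>j. ?g j \<bullet> d) ` J))"
      if "finite J" "J \<noteq> {}" for J and S :: "(real ^ 'n) set"
      using that
      by (induction J rule: finite_ne_induct) (auto intro!: continuous_intros)
    show ?thesis unfolding model_def by (intro continuous_intros *) auto
  qed
  ultimately obtain d where d: "d \<in> ?K" "\<And>e. e \<in> ?K \<Longrightarrow> model F L x d \<le> model F L x e"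
    using continuous_attains_inf[of ?K "model F L x"] by blast
  have le: "model F L x d \<le> model F L x e" if e: "e \<in> dirs \<Omega> x" for e
  proof (cases "e \<in> cball 0 R")
    case True
    then show ?thesis using d e by blast
  next
    case False
    have "- (norm (?g undefined) * norm e) \<le> ?g undefined \<bullet> e"
      using Cauchy_Schwarz_ineq2[of "?g undefined" e] by linarith
    also have "\<dots> \<le> (MAX j. ?g j \<bullet> e)" by (intro Max_ge) auto
    finally have 1: "- (norm (?g undefined) * norm e) \<le> (MAX j. ?g j \<bullet> e)" .
    have "norm (?g undefined) \<le> L / 2 * norm e"
      using False assms by (simp add: R_def field_simps)
    then have "norm (?g undefined) * norm e \<le> L / 2 * norm e * norm e"
      by (intro mult_right_mono) auto
    then have "0 \<le> model F L x e"
      using 1 by (simp add: model_def power2_eq_square)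
    then show ?thesis using d(2)[OF \<open>0 \<in> ?K\<close>] 0 by simp
  qed
  have "theta F \<Omega> L x = model F L x d"
    unfolding theta_def using d(1) le by (intro cInf_eq_minimum) auto
  moreover have "d \<in> opt_dirs F \<Omega> L x"
    using d(1) le by (auto simp: opt_dirs_def is_arg_min_linorder)
  ultimately show ?thesis using that by blast
qed

end

theory Submission
  imports Defs
begin

text \<open>Write \<open>g\<^sub>j\<close> for the gradient of \<open>f\<^sub>j\<close>. Since \<open>L\<close> dominates every Lipschitz constant, the descent
  lemma gives \<open>f\<^sub>j (x\<^sub>k\<^sub>+\<^sub>1) - f\<^sub>j (x\<^sub>k) \<le> \<theta>\<^sub>L (x\<^sub>k) \<le> 0\<close> for every \<open>j\<close>. Hence the iterates stay in the
  bounded level set of \<open>F x\<^sub>0\<close> and have a cluster point. Along a subsequence converging to \<open>l\<close>,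
  the monotone values \<open>f\<^sub>j (x\<^sub>k)\<close> converge to \<open>f\<^sub>j l\<close>, so their differences, and with them
  \<open>\<theta>\<^sub>L (x\<^sub>k)\<close>, tend to \<open>0\<close>. For a feasible point \<open>y\<close> the model value of the direction \<open>y - x\<^sub>k\<close> is at
  least \<open>\<theta>\<^sub>L (x\<^sub>k)\<close>; in the limit the model value of \<open>y - l\<close> is nonnegative, so \<open>\<theta>\<^sub>L l = 0\<close>.\<close>

text \<open>Subtracting the claimed quadratic upper bound from \<open>f\<close> along the segment
  gives, up to a constant, the function \<open>\<phi>\<close>. By Cauchy-Schwarz and the Lipschitz
  bound its derivative is nonpositive for \<open>t \<ge> 0\<close>, and
  \<open>\<phi> 1 \<le> \<phi> 0\<close> is the claim.\<close>

lemma descent_lemma: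
  fixes f :: "'a::real_inner \<Rightarrow> real"
  assumes f: "\<And>z. GDERIV f z :> g z" and g: "C-lipschitz_on UNIV g"
  shows "f (x + d) \<le> f x + g x \<bullet> d + C / 2 * (norm d)\<^sup>2"
proof -
  define \<phi> where "\<phi> t = f (x + t *\<^sub>R d) - t * (g x \<bullet> d) - C / 2 * t\<^sup>2 * (norm d)\<^sup>2" for t
  have "\<exists>y. (\<phi> has_real_derivative y) (at t) \<and> y \<le> 0" if "0 \<le> t" for t
  proof (intro exI conjI)
    have "(f has_derivative (\<lambda>h. h \<bullet> g (x + t *\<^sub>R d))) (at (x + t *\<^sub>R d))"
      using f by (simp add: gderiv_def)
    then have "((\<lambda>t. f (x + t *\<^sub>R d)) has_derivative (\<lambda>h. (h *\<^sub>R d) \<bullet> g (x + t *\<^sub>R d))) (at t)"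
      by (rule has_derivative_compose[rotated]) (auto intro!: derivative_eq_intros)
    also have "(\<lambda>h. (h *\<^sub>R d) \<bullet> g (x + t *\<^sub>R d)) = (*) (g (x + t *\<^sub>R d) \<bullet> d)"
      by (simp add: fun_eq_iff inner_commute)
    finally have "((\<lambda>t. f (x + t *\<^sub>R d)) has_real_derivative g (x + t *\<^sub>R d) \<bullet> d) (at t)"
      by (simp add: has_field_derivative_def)
    then show "(\<phi> has_real_derivative
        g (x + t *\<^sub>R d) \<bullet> d - g x \<bullet> d - C * t * (norm d)\<^sup>2) (at t)"
      unfolding \<phi>_def by (auto intro!: derivative_eq_intros)
    have "(g (x + t *\<^sub>R d) - g x) \<bullet> d \<le> norm (g (x + t *\<^sub>R d) - g x) * norm d"
      by (rule norm_cauchy_schwarz)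
    also have "\<dots> \<le> (C * (t * norm d)) * norm d"
      using lipschitz_onD[OF g, of "x + t *\<^sub>R d" x] that
      by (intro mult_right_mono) (auto simp: dist_norm)
    finally show "g (x + t *\<^sub>R d) \<bullet> d - g x \<bullet> d - C * t * (norm d)\<^sup>2 \<le> 0"
      by (simp add: inner_diff_left power2_eq_square mult.assoc)
  qed
  then have "\<phi> 1 \<le> \<phi> 0"
    by (intro DERIV_nonpos_imp_nonincreasing[OF zero_le_one])
  then show ?thesis by (simp add: \<phi>_def)
qed

text \<open>\<open>grad\<close> is a definite description, so a gradient must first be exhibited.
  The adjoint of the derivative, applied to \<open>1\<close>, is its Riesz representative.\<close>

lemma GDERIV_grad_component:
  fixes F :: "real ^ 'n \<Rightarrow> real ^ 'm"
  assumes "F differentiable (at x)"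
  shows "GDERIV (\<lambda>y. F y $ j) x :> grad (\<lambda>y. F y $ j) x"
proof -
  obtain F' where "(F has_derivative F') (at x)"
    using assms by (auto simp: differentiable_def)
  then have D: "((\<lambda>y. F y $ j) has_derivative (\<lambda>h. F' h $ j)) (at x)"
    by (rule bounded_linear.has_derivative[OF bounded_linear_vec_nth])
  then have "linear (\<lambda>h. F' h $ j)"
    by (rule has_derivative_linear)
  then have "(\<lambda>h. F' h $ j) = (\<lambda>h. h \<bullet> adjoint (\<lambda>h. F' h $ j) 1)"
    by (simp add: adjoint_works)
  with D have "GDERIV (\<lambda>y. F y $ j) x :> adjoint (\<lambda>h. F' h $ j) 1"
    by (simp add: gderiv_def)
  then show ?thesis using grad_eqI by metis
qed

lemma model_zero [simp]: "model F L x 0 = 0"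
  by (simp add: model_def)

lemma theta_eq_model:
  assumes "d \<in> opt_dirs F \<Omega> L x"
  shows "theta F \<Omega> L x = model F L x d"
  using assms unfolding theta_def
  by (intro cInf_eq_minimum) (auto simp: opt_dirs_def is_arg_min_linorder)

lemma theta_le_model:
  assumes "d \<in> opt_dirs F \<Omega> L x" "e \<in> dirs \<Omega> x"
  shows "theta F \<Omega> L x \<le> model F L x e"
  using assms by (simp add: theta_eq_model[OF assms(1)] opt_dirs_def is_arg_min_linorder)

text \<open>The zero direction is feasible with model value \<open>0\<close>, so nonnegativity of
  the model makes it a minimizer.\<close>

lemma L_stationaryI:
  assumes "x \<in> \<Omega>" "\<And>d. d \<in> dirs \<Omega> x \<Longrightarrow> 0 \<le> model F L x d"
  shows "L_stationary F \<Omega> L x"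
proof -
  have "0 \<in> dirs \<Omega> x" using assms(1) by (simp add: dirs_def)
  then have "0 \<in> opt_dirs F \<Omega> L x"
    using assms(2) by (auto simp: opt_dirs_def is_arg_min_linorder)
  then show ?thesis
    using assms(1) by (simp add: L_stationary_def theta_eq_model)
qed

lemma tendsto_Max_image:
  fixes f :: "'a \<Rightarrow> 'i \<Rightarrow> 'b::linorder_topology"
  assumes "finite I" "I \<noteq> {}" "\<And>i. i \<in> I \<Longrightarrow> ((\<lambda>x. f x i) \<longlongrightarrow> l i) A"
  shows "((\<lambda>x. Max (f x ` I)) \<longlongrightarrow> Max (l ` I)) A"
  using assms by (induction I rule: finite_ne_induct) (auto intro!: tendsto_max)

text \<open>Continuity is joint because the base point moves together with the direction in the
  final limit.\<close>

lemma tendsto_model: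
  fixes F :: "real ^ 'n \<Rightarrow> real ^ 'm"
  assumes "\<And>j. continuous_on UNIV (grad (\<lambda>y. F y $ j))"
    and "(u \<longlongrightarrow> x) A" "(v \<longlongrightarrow> d) A"
  shows "((\<lambda>k. model F L (u k) (v k)) \<longlongrightarrow> model F L x d) A"
proof -
  have "((\<lambda>k. grad (\<lambda>y. F y $ j) (u k)) \<longlongrightarrow> grad (\<lambda>y. F y $ j) x) A" for j
    by (rule continuous_on_tendsto_compose[OF assms(1,2)]) auto
  then show ?thesis
    unfolding model_def using assms(3)
    by (intro tendsto_intros tendsto_Max_image) auto
qed

text \<open>Replacing the slope of component \<open>j\<close> by the maximum and \<open>C\<close> by
  \<open>L\<close> turns the descent estimate into the model value at the minimizer
  \<open>d\<close>.\<close>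

lemma component_decrease:
  fixes F :: "real ^ 'n \<Rightarrow> real ^ 'm"
  assumes F: "\<And>z. F differentiable (at z)"
    and lip: "C-lipschitz_on UNIV (grad (\<lambda>y. F y $ j))" and "C \<le> L"
    and d: "d \<in> opt_dirs F \<Omega> L x"
  shows "F (x + d) $ j - F x $ j \<le> theta F \<Omega> L x"
proof -
  let ?g = "\<lambda>j. grad (\<lambda>y. F y $ j) x"
  have "F (x + d) $ j - F x $ j \<le> ?g j \<bullet> d + C / 2 * (norm d)\<^sup>2"
    using descent_lemma[of "\<lambda>y. F y $ j", OF GDERIV_grad_component[OF F] lip, of x d] by simp
  also have "\<dots> \<le> (MAX j. ?g j \<bullet> d) + L / 2 * (norm d)\<^sup>2"
    using \<open>C \<le> L\<close> by (intro add_mono Max_ge mult_right_mono) auto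
  also have "\<dots> = theta F \<Omega> L x"
    by (simp add: theta_eq_model[OF d] model_def)
  finally show ?thesis .
qed

text \<open>Since \<open>k \<le> r k\<close>, the subsequence limit \<open>a\<close> bounds all of
  \<open>X\<close> from below. So \<open>X\<close> converges, and the subsequence identifies its
  limit.\<close>

lemma LIMSEQ_antimono_subseq:
  fixes X :: "nat \<Rightarrow> real"
  assumes X: "antimono X" and r: "strict_mono r" and lim: "(X \<circ> r) \<longlonglongrightarrow> a"
  shows "X \<longlonglongrightarrow> a"
proof -
  have "antimono (X \<circ> r)"
    using X r by (simp add: monotone_def strict_mono_less_eq)
  then have "a \<le> X (r k)" for k
    using decseq_ge[OF _ lim] by simp
  then have "a \<le> X k" for k
    using order_trans[OF _ antimonoD[OF X strict_mono_imp_increasing[OF r]]] by blast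
  then obtain b where b: "X \<longlonglongrightarrow> b"
    using decseq_convergent[OF X] by blast
  with LIMSEQ_subseq_LIMSEQ[OF b r] lim have "b = a"
    using LIMSEQ_unique by blast
  with b show ?thesis by simp
qed

theorem proposition3:
  fixes F :: "real ^ 'n \<Rightarrow> real ^ 'm"
    and s :: nat
    and Lf :: "'m \<Rightarrow> real"
    and L :: real
    and x0 :: "real ^ 'n"
    and x :: "nat \<Rightarrow> real ^ 'n"
  assumes "continuously_differentiable F"
    and "1 \<le> s" and "s < CARD('n)"
    and "\<And>j. (Lf j)-lipschitz_on UNIV (grad (\<lambda>y. F y $ j))"
    and "\<And>z. bounded {x \<in> sparse_set s. F x \<le> z}"
    and "L > (MAX j. Lf j)"
    and "x0 \<in> sparse_set s"
    and "MOIHT_sequence F (sparse_set s) L x0 x"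
  shows "(\<exists>l. cluster_point x l) \<and>
         (\<forall>l. cluster_point x l \<longrightarrow> L_stationary F (sparse_set s) L l)"
proof -
  let ?\<Omega> = "sparse_set s :: (real ^ 'n) set"
  let ?\<theta> = "\<lambda>k. theta F ?\<Omega> L (x k)"
  have F: "F differentiable (at z)" for z
    using assms(1) by (auto simp: continuously_differentiable_def differentiable_def)
  have contg: "continuous_on UNIV (grad (\<lambda>y. F y $ j))" for j
    using assms(4) lipschitz_on_continuous_on by blast
  have LfL: "Lf j \<le> L" for j
    using assms(6) by (simp add: less_imp_le)
  obtain d where d: "\<And>k. d k \<in> opt_dirs F ?\<Omega> L (x k)" and step: "\<And>k. x (Suc k) = x k + d k"
    using assms(8) unfolding MOIHT_sequence_def by metis
  have x0: "x 0 = x0"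
    using assms(8) by (simp add: MOIHT_sequence_def)
  have feas: "x k \<in> ?\<Omega>" for k
  proof (cases k)
    case 0
    then show ?thesis using assms(7) x0 by simp
  next
    case (Suc i)
    then show ?thesis
      using d[of i] by (simp add: step opt_dirs_def is_arg_min_linorder dirs_def)
  qed
  have theta_le: "?\<theta> k \<le> 0" for k
    using theta_le_model[OF d[of k], of 0] feas by (simp add: dirs_def)
  have dec: "F (x (Suc k)) $ j - F (x k) $ j \<le> ?\<theta> k" for j k
    unfolding step by (rule component_decrease[OF F assms(4) LfL d])
  then have anti: "antimono (\<lambda>k. F (x k) $ j)" for j
    using theta_le by (intro decseq_SucI) (meson diff_le_0_iff_le order_trans)
  have "range x \<subseteq> {y \<in> ?\<Omega>. F y \<le> F x0}"
    using feas antimonoD[OF anti, of 0] by (auto simp: less_eq_vec_def x0)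
  then have "bounded (range x)"
    using assms(5) bounded_subset by blast
  then obtain l where "cluster_point x l"
    unfolding cluster_point_def using bounded_imp_convergent_subsequence by blast
  moreover have "L_stationary F ?\<Omega> L l" if cluster: "cluster_point x l" for l
  proof (rule L_stationaryI)
    obtain r where r: "strict_mono r" and lim: "(x \<circ> r) \<longlonglongrightarrow> l"
      using cluster by (auto simp: cluster_point_def)
    show "l \<in> ?\<Omega>"
      using closed_sequentially[OF closed_sparse_set _ lim] feas by simp
    \<comment> \<open>One arbitrary component suffices: its decrease bounds \<theta> from below, and
      \<open>0\<close> bounds it from above.\<close>
    fix j :: 'm
    have "isCont (\<lambda>y. F y $ j) l"
      using differentiable_imp_continuous_within[OF F] by (intro continuous_intros)
    from isCont_tendsto_compose[OF this lim]
    have "((\<lambda>k. F (x k) $ j) \<circ> r) \<longlonglongrightarrow> F l $ j"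
      by (simp add: o_def)
    then have Fl: "(\<lambda>k. F (x k) $ j) \<longlonglongrightarrow> F l $ j"
      by (rule LIMSEQ_antimono_subseq[OF anti r])
    have "(\<lambda>k. F (x (Suc k)) $ j - F (x k) $ j) \<longlonglongrightarrow> 0"
      using tendsto_diff[OF LIMSEQ_Suc[OF Fl] Fl] by simp
    then have "?\<theta> \<longlonglongrightarrow> 0"
      by (rule tendsto_sandwich[rotated 2, OF _ tendsto_const])
        (use dec theta_le in auto)
    then have theta_lim: "(\<lambda>k. ?\<theta> (r k)) \<longlonglongrightarrow> 0"
      using LIMSEQ_subseq_LIMSEQ[OF _ r] by (auto simp: o_def)
    fix e assume e: "e \<in> dirs ?\<Omega> l"
    \<comment> \<open>The direction \<open>e\<close> is feasible at \<open>l\<close> but perhaps not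
      at the iterates. Aiming from each iterate at the fixed feasible point \<open>l + e\<close>
      keeps feasibility, and these directions converge to \<open>e\<close>.\<close>
    have "(\<lambda>k. model F L (x (r k)) (l + e - x (r k))) \<longlonglongrightarrow> model F L l (l + e - l)"
      using lim by (intro tendsto_model contg tendsto_intros) (simp_all add: o_def)
    moreover have "?\<theta> (r k) \<le> model F L (x (r k)) (l + e - x (r k))" for k
      using e by (intro theta_le_model[OF d]) (simp add: dirs_def)
    ultimately have "0 \<le> model F L l (l + e - l)"
      using theta_lim by (intro LIMSEQ_le) auto
    then show "0 \<le> model F L l e" by simp
  qed
  ultimately show ?thesis by blast
qed

end
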